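(* Let $X$ be a nonempty set. The monoid $\Omega(X)$ is regular if and only if $\Omega(X)=S(X)$.
   Context: $\Omega(X)$ is the monoid, under composition, of all injective maps $X\to X$, and $S(X)$ is the symmetric group of all bijections $X\to X$. A monoid $M$ is regular if for every $x\in M$ there is $y\in M$ with $xyx=x$. *)

theory Defs
  imports "HOL-Algebra.Bij"
begin

text \<open>As in \<^theory>\<open>HOL-Algebra.Bij\<close>, maps on \<open>X\<close> are represented by extensional functions (so that
  each map \<open>X \<rightarrow> X\<close> has exactly one representative), and the product is composition restricted
  to the carrier. The symmetric group of \<open>X\<close> is \<^const>\<open>BijGroup\<close>.\<close>

definition Inj :: "'a set \<Rightarrow> ('a \<Rightarrow> 'a) set"
  where "Inj X = {f \<in> X \<rightarrow>\<^sub>E X. inj_on f X}"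

definition InjMonoid :: "'a set \<Rightarrow> ('a \<Rightarrow> 'a) monoid"
  where "InjMonoid X =
    \<lparr>carrier = Inj X,
     mult = \<lambda>g \<in> Inj X. \<lambda>f \<in> Inj X. compose X g f,
     one = \<lambda>x \<in> X. x\<rparr>"

locale regular_monoid = monoid M for M (structure) +
  assumes regular: "x \<in> carrier M \<Longrightarrow> \<exists>y \<in> carrier M. x \<otimes> y \<otimes> x = x"

lemma id_Inj: "(\<lambda>x \<in> X. x) \<in> Inj X"
  by (simp add: Inj_def inj_on_def)

lemma compose_Inj: "g \<in> Inj X \<Longrightarrow> f \<in> Inj X \<Longrightarrow> compose X g f \<in> Inj X"
proof -
  assume g: "g \<in> Inj X" and f: "f \<in> Inj X"
  then have gX: "g \<in> X \<rightarrow> X" "inj_on g X" and fX: "f \<in> X \<rightarrow> X" "inj_on f X"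
    by (simp_all add: Inj_def PiE_def)
  have "compose X g f \<in> X \<rightarrow>\<^sub>E X"
    using funcset_compose[OF fX(1) gX(1)] by (simp add: PiE_def)
  moreover have "inj_on (compose X g f) X"
  proof (rule inj_onI)
    fix x y
    assume "x \<in> X" "y \<in> X" "compose X g f x = compose X g f y"
    then have "g (f x) = g (f y)"
      by (simp add: compose_eq)
    then have "f x = f y"
      by (rule inj_onD[OF gX(2)]) (rule funcset_mem[OF fX(1)], fact)+
    then show "x = y"
      by (rule inj_onD[OF fX(2)]) fact+
  qed
  ultimately show ?thesis
    by (simp add: Inj_def)
qed

lemma monoid_InjMonoid: "monoid (InjMonoid X)"
proof (rule monoidI)
  fix f g h
  assume "f \<in> carrier (InjMonoid X)" "g \<in> carrier (InjMonoid X)" "h \<in> carrier (InjMonoid X)"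
  then have fgh: "f \<in> Inj X" "g \<in> Inj X" "h \<in> Inj X"
    by (simp_all add: InjMonoid_def)
  then have "h \<in> X \<rightarrow> X"
    by (simp add: Inj_def PiE_def)
  then have "compose X f (compose X g h) = compose X (compose X f g) h"
    by (rule compose_assoc)
  with fgh show "f \<otimes>\<^bsub>InjMonoid X\<^esub> g \<otimes>\<^bsub>InjMonoid X\<^esub> h = f \<otimes>\<^bsub>InjMonoid X\<^esub> (g \<otimes>\<^bsub>InjMonoid X\<^esub> h)"
    by (simp add: InjMonoid_def compose_Inj)
next
  fix f
  assume "f \<in> carrier (InjMonoid X)"
  then have f: "f \<in> Inj X" "f \<in> X \<rightarrow> X" "f \<in> extensional X"
    by (simp_all add: InjMonoid_def Inj_def PiE_def)
  show "\<one>\<^bsub>InjMonoid X\<^esub> \<otimes>\<^bsub>InjMonoid X\<^esub> f = f"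
    using f by (simp add: InjMonoid_def id_Inj)
  show "f \<otimes>\<^bsub>InjMonoid X\<^esub> \<one>\<^bsub>InjMonoid X\<^esub> = f"
    using f by (simp add: InjMonoid_def id_Inj)
next
  fix f g
  assume "f \<in> carrier (InjMonoid X)" "g \<in> carrier (InjMonoid X)"
  then have "f \<in> Inj X" "g \<in> Inj X"
    by (simp_all add: InjMonoid_def)
  then show "f \<otimes>\<^bsub>InjMonoid X\<^esub> g \<in> carrier (InjMonoid X)"
    by (simp add: InjMonoid_def compose_Inj)
next
  show "\<one>\<^bsub>InjMonoid X\<^esub> \<in> carrier (InjMonoid X)"
    by (simp add: InjMonoid_def id_Inj)
qed

end

theory Submission
  imports Defs
begin

text \<open>Injective maps are left cancellable. If \<open>f g f = f\<close> with \<open>f\<close>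
  and \<open>g\<close> injective, cancelling \<open>f\<close> gives \<open>g f = id\<close>; hence
  \<open>g f g = g\<close>, and cancelling \<open>g\<close> gives \<open>f g = id\<close>, so
  \<open>f\<close> is bijective (\<open>Inj_regular_imp_Bij\<close>). Conversely, every group is
  regular, with the inverse as witness.\<close>

lemma Bij_subset_Inj: "Bij X \<subseteq> Inj X"
  by (auto simp: Bij_def Inj_def PiE_def bij_betw_def)

text \<open>Both records are built by the same formulas from their carriers, so they agree once the
  carriers do, and one inclusion of carriers always holds.\<close>

lemma InjMonoid_eq_BijGroup_iff: "InjMonoid X = BijGroup X \<longleftrightarrow> Inj X \<subseteq> Bij X"
proof
  assume "InjMonoid X = BijGroup X"
  then have "carrier (InjMonoid X) = carrier (BijGroup X)"
    by simp
  then show "Inj X \<subseteq> Bij X"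
    by (simp add: InjMonoid_def BijGroup_def)
next
  assume "Inj X \<subseteq> Bij X"
  with Bij_subset_Inj have "Inj X = Bij X"
    by blast
  then show "InjMonoid X = BijGroup X"
    by (simp add: InjMonoid_def BijGroup_def)
qed

lemma (in group) regular_monoid: "regular_monoid G"
proof
  fix x
  assume "x \<in> carrier G"
  then show "\<exists>y \<in> carrier G. x \<otimes> y \<otimes> x = x"
    by (intro bexI[of _ "inv x"]) simp_all
qed

text \<open>Cancelling the injective maps \<open>f\<close> and then \<open>g\<close> in \<open>f g f = f\<close> makes \<open>g\<close> a two-sided inverse of \<open>f\<close>.\<close>

lemma Inj_regular_imp_Bij:
  assumes f: "f \<in> Inj X" and g: "g \<in> Inj X"
    and fgf: "compose X (compose X f g) f = f"
  shows "f \<in> Bij X"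
proof -
  have fX: "f \<in> X \<rightarrow> X" "inj_on f X" "f \<in> extensional X" and gX: "g \<in> X \<rightarrow> X" "inj_on g X"
    using f g by (simp_all add: Inj_def PiE_def)
  have gf: "g (f a) = a" if "a \<in> X" for a
  proof -
    have "f (g (f a)) = f a"
      using fun_cong[OF fgf, of a] that fX(1) by (simp add: compose_def Pi_iff)
    then show ?thesis
      by (rule inj_onD[OF fX(2)]) (use that fX(1) gX(1) in auto)
  qed
  have fg: "f (g b) = b" if "b \<in> X" for b
  proof -
    \<comment> \<open>This is \<open>gf\<close> at the point \<open>g b\<close>; that
      \<open>g\<close> too is injective lets the outer \<open>g\<close> be cancelled.\<close>
    have "g (f (g b)) = g b"
      using that gX(1) by (auto intro: gf)
    then show ?thesis
      by (rule inj_onD[OF gX(2)]) (use that fX(1) gX(1) in auto)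
  qed
  have "bij_betw f X X"
    using fX(1) gX(1) gf fg by (auto intro!: bij_betw_byWitness[where f' = g])
  with fX(3) show ?thesis
    by (simp add: Bij_def)
qed

theorem proposition3p9:
  fixes X :: "'a set"
  assumes "X \<noteq> {}"
  shows "regular_monoid (InjMonoid X) \<longleftrightarrow> InjMonoid X = BijGroup X"
proof
  assume "regular_monoid (InjMonoid X)"
  then interpret regular_monoid "InjMonoid X" .
  have "Inj X \<subseteq> Bij X"
  proof
    fix f
    assume f: "f \<in> Inj X"
    then obtain g where "g \<in> Inj X" "compose X (compose X f g) f = f"
      using regular[of f] by (auto simp: InjMonoid_def compose_Inj)
    with f show "f \<in> Bij X"
      by (rule Inj_regular_imp_Bij)
  qed
  then show "InjMonoid X = BijGroup X"
    by (simp add: InjMonoid_eq_BijGroup_iff)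
next
  assume "InjMonoid X = BijGroup X"
  then show "regular_monoid (InjMonoid X)"
    using group.regular_monoid[OF group_BijGroup] by simp
qed

end
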